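(* Let $\mathbf{A}\in\mathbb{R}^{n\times n}$ be a positive semidefinite matrix. For any $\epsilon,\delta\in(0,1)$ there exists an algorithm (the sampling algorithm described in the context) that outputs an estimate $\widehat F$ satisfying $$(1-\epsilon)\|\mathbf{A}\|_{\mathrm F}^2\le \widehat F\le (1+\epsilon)\|\mathbf{A}\|_{\mathrm F}^2\quad\text{with probability}\ \ge 1-\delta.$$ The algorithm reads $O(n\log(1/\delta)/\epsilon^2)$ entries of $\mathbf{A}$ and performs $O(n\log(1/\delta)/\epsilon^2)$ arithmetic operations.
   Context: $\|\cdot\|_{\mathrm F}$ is the Frobenius norm and $\operatorname{tr}$ is the trace. A positive semidefinite (psd) matrix is a real symmetric matrix with $\mathbf{x}^\top\mathbf{A}\mathbf{x}\ge 0$ for all $\mathbf{x}\in\mathbb{R}^n$. Access model: the algorithm interacts with $\mathbf{A}$ by querying individual entries $\mathbf{A}_{ij}$; costs are reported as the number of entry queries and the total number of arithmetic operations. Algorithm (input: nonzero psd $\mathbf{A}$ and a number of trials $s$). Read the diagonal of $\mathbf{A}$ and define the distribution $\mathcal{D}(i)=\mathbf{A}_{ii}/\operatorname{tr}(\mathbf{A})$ on $\{1,\dots,n\}$. For $k=1,\dots,s$: sample independent $I,J\sim\mathcal{D}$ and set $X_k=\mathbf{A}_{IJ}^2/(\mathbf{A}_{II}\mathbf{A}_{JJ})$. Return $\widehat F=\operatorname{tr}(\mathbf{A})^2\cdot\frac1s\sum_{k=1}^s X_k$. The number of trials used is $s=\lceil 3n\log(2/\delta)/\epsilon^2\rcei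l$.
   Formalization: The O(n log(1/δ)/ε²) bounds are proved with a constant uniform in n, A, ε and in δ ≤ δ₀, for each fixed δ₀ < 1; one constant for all δ in (0,1) is impossible, since log(1/δ) tends to 0 as δ → 1 while the diagonal must still be read. *)

theory Defs
  imports "HOL-Probability.Probability" "Jordan_Normal_Form.Matrix"
begin

definition psd_mat :: "nat \<Rightarrow> real mat \<Rightarrow> bool" where
  "psd_mat n A \<longleftrightarrow> A \<in> carrier_mat n n \<and> transpose_mat A = A \<and>
     (\<forall>x \<in> carrier_vec n. scalar_prod x (mult_mat_vec A x) \<ge> 0)"

definition mat_trace :: "real mat \<Rightarrow> real" where
  "mat_trace A = (\<Sum>i<dim_row A. A $$ (i, i))"

definition frobenius_norm :: "real mat \<Rightarrow> real" where
  "frobenius_norm A = sqrt (\<Sum>i<dim_row A. \<Sum>j<dim_col A. (A $$ (i, j))\<^sup>2)"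


section \<open>The law of the sampling estimator\<close>

text \<open>For a nonzero psd matrix the weights below are nonnegative and sum to 1, so that
  \<open>embed_pmf\<close> is the distribution with these point masses. Indices are zero-based.\<close>

definition diag_pmf :: "real mat \<Rightarrow> nat pmf" where
  "diag_pmf A = embed_pmf (\<lambda>i. if i < dim_row A then A $$ (i, i) / mat_trace A else 0)"

definition trial_pmf :: "real mat \<Rightarrow> real pmf" where
  "trial_pmf A = do {
     I \<leftarrow> diag_pmf A;
     J \<leftarrow> diag_pmf A;
     return_pmf ((A $$ (I, J))\<^sup>2 / (A $$ (I, I) * A $$ (J, J)))
   }"

definition estimate_pmf :: "nat \<Rightarrow> real mat \<Rightarrow> real pmf" where
  "estimate_pmf s A =
     map_pmf (\<lambda>xs. (mat_trace A)\<^sup>2 * (1 / real s * sum_list xs)) (replicate_pmf s (trial_pmf A))"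

definition num_trials :: "nat \<Rightarrow> real \<Rightarrow> real \<Rightarrow> nat" where
  "num_trials n \<epsilon> \<delta> = nat \<lceil>3 * real n * ln (2 / \<delta>) / \<epsilon>\<^sup>2\<rceil>"


section \<open>Randomized programs with entry queries\<close>

text \<open>A program of type \<open>('v, 'a) prog\<close> handles real numbers only as values of the type
  parameter \<open>'v\<close>. A program that is polymorphic in \<open>'v\<close> therefore has no access to the matrix
  except through \<open>Query\<close>, and it can combine or compare numbers only through the counted
  operations \<open>Arith\<close>, \<open>Less\<close> and \<open>Coin\<close>. \<open>Uniform m\<close> draws an index uniformly from
  \<open>{0..<m}\<close>; \<open>Coin p\<close> returns true with probability \<open>p\<close>.\<close>

datatype arith_op = Plus | Minus | Times | Divide

datatype ('v, 'a) prog =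
    Return 'a
  | Query nat nat "'v \<Rightarrow> ('v, 'a) prog"
  | Const real "'v \<Rightarrow> ('v, 'a) prog"
  | Arith arith_op 'v 'v "'v \<Rightarrow> ('v, 'a) prog"
  | Less 'v 'v "bool \<Rightarrow> ('v, 'a) prog"
  | Uniform nat "nat \<Rightarrow> ('v, 'a) prog"
  | Coin 'v "bool \<Rightarrow> ('v, 'a) prog"

primrec bind_prog :: "('v, 'a) prog \<Rightarrow> ('a \<Rightarrow> ('v, 'b) prog) \<Rightarrow> ('v, 'b) prog" where
  "bind_prog (Return x) f = f x"
| "bind_prog (Query i j k) f = Query i j (\<lambda>x. bind_prog (k x) f)"
| "bind_prog (Const c k) f = Const c (\<lambda>x. bind_prog (k x) f)"
| "bind_prog (Arith c x y k) f = Arith c x y (\<lambda>z. bind_prog (k z) f)"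
| "bind_prog (Less x y k) f = Less x y (\<lambda>b. bind_prog (k b) f)"
| "bind_prog (Uniform m k) f = Uniform m (\<lambda>i. bind_prog (k i) f)"
| "bind_prog (Coin p k) f = Coin p (\<lambda>b. bind_prog (k b) f)"

adhoc_overloading Monad_Syntax.bind \<rightleftharpoons> bind_prog

primrec arith :: "arith_op \<Rightarrow> real \<Rightarrow> real \<Rightarrow> real" where
  "arith Plus x y = x + y"
| "arith Minus x y = x - y"
| "arith Times x y = x * y"
| "arith Divide x y = x / y"

text \<open>An outcome \<open>(x, q, t)\<close> of a run consists of the result, the number of entry queries and the
  number of all other operations. Loading a constant, comparing two numbers and each random draw
  all count as one operation; index bookkeeping and list access are not operations on numbers and
  are free.\<close>

abbreviation (input) count_op :: "('a \<times> nat \<times> nat) pmf \<Rightarrow> ('a \<times> nat \<times> nat) pmf" where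
  "count_op \<equiv> map_pmf (\<lambda>(x, q, t). (x, q, Suc t))"

abbreviation (input) count_query :: "('a \<times> nat \<times> nat) pmf \<Rightarrow> ('a \<times> nat \<times> nat) pmf" where
  "count_query \<equiv> map_pmf (\<lambda>(x, q, t). (x, Suc q, t))"

primrec run :: "real mat \<Rightarrow> (real, 'a) prog \<Rightarrow> ('a \<times> nat \<times> nat) pmf" where
  "run A (Return x) = return_pmf (x, 0, 0)"
| "run A (Query i j k) = count_query (run A (k (A $$ (i, j))))"
| "run A (Const c k) = count_op (run A (k c))"
| "run A (Arith c x y k) = count_op (run A (k (arith c x y)))"
| "run A (Less x y k) = count_op (run A (k (x < y)))"
| "run A (Uniform m k) = count_op (bind_pmf (pmf_of_set {..<m}) (\<lambda>i. run A (k i)))"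
| "run A (Coin p k) = count_op (bind_pmf (bernoulli_pmf p) (\<lambda>b. run A (k b)))"

primrec map_prog :: "('a \<Rightarrow> ('v, 'b) prog) \<Rightarrow> 'a list \<Rightarrow> ('v, 'b list) prog" where
  "map_prog f [] = Return []"
| "map_prog f (x # xs) = do { y \<leftarrow> f x; ys \<leftarrow> map_prog f xs; Return (y # ys) }"

primrec sum_prog :: "'v list \<Rightarrow> ('v, 'v) prog" where
  "sum_prog [] = Const 0 Return"
| "sum_prog (x # xs) = do { y \<leftarrow> sum_prog xs; Arith Plus x y Return }"


section \<open>The sampling algorithm as a program\<close>

text \<open>Samples from a distribution on \<open>n\<close> points are drawn by Walker's alias method, which takes
  constantly many operations per sample after linear preprocessing. The \<open>n\<close> probabilities are
  scaled by \<open>n\<close>, so that they have mean 1, and are redistributed into \<open>n\<close> cells \<open>(i, p, j)\<close> of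
  mass 1, of which \<open>p\<close> belongs to the point \<open>i\<close> and \<open>1 - p\<close> to the point \<open>j\<close>. The first list below
  holds points of remaining mass less than 1, the second one those of remaining mass at least 1; the argument \<open>c\<close> is the
  constant 1.\<close>

fun alias_cells ::
  "'v \<Rightarrow> (nat \<times> 'v) list \<Rightarrow> (nat \<times> 'v) list \<Rightarrow> ('v, (nat \<times> 'v \<times> nat) list) prog" where
  "alias_cells c ((i, p) # ss) ((j, q) # ls) = do {
     gap \<leftarrow> Arith Minus c p Return;
     r \<leftarrow> Arith Minus q gap Return;
     small \<leftarrow> Less r c Return;
     cells \<leftarrow> (if small then alias_cells c ((j, r) # ss) ls
              else alias_cells c ss ((j, r) # ls));
     Return ((i, p, j) # cells)
   }"
| "alias_cells c ss ls = Return (map (\<lambda>(i, _). (i, c, i)) (ss @ ls))"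

definition alias_table :: "'v list \<Rightarrow> 'v \<Rightarrow> ('v, (nat \<times> 'v \<times> nat) list) prog" where
  "alias_table ws tot = do {
     c \<leftarrow> Const 1 Return;
     m \<leftarrow> Const (real (length ws)) Return;
     items \<leftarrow> map_prog (\<lambda>i. do {
         x \<leftarrow> Arith Divide (ws ! i) tot Return;
         p \<leftarrow> Arith Times m x Return;
         small \<leftarrow> Less p c Return;
         Return (small, i, p)
       }) [0..<length ws];
     alias_cells c (map snd (filter fst items)) (map snd (filter (\<lambda>it. \<not> fst it) items))
   }"

definition draw :: "(nat \<times> 'v \<times> nat) list \<Rightarrow> ('v, nat) prog" where
  "draw cells = do {
     k \<leftarrow> Uniform (length cells) Return;
     let (i, p, j) = cells ! k;
     b \<leftarrow> Coin p Return;
     Return (if b then i else j)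
   }"

definition trial :: "'v list \<Rightarrow> (nat \<times> 'v \<times> nat) list \<Rightarrow> ('v, 'v) prog" where
  "trial diag cells = do {
     I \<leftarrow> draw cells;
     J \<leftarrow> draw cells;
     a \<leftarrow> Query I J Return;
     num \<leftarrow> Arith Times a a Return;
     den \<leftarrow> Arith Times (diag ! I) (diag ! J) Return;
     Arith Divide num den Return
   }"

text \<open>The zero matrix, for which the sampling distribution is undefined, is recognized by its
  trace and answered with 0.\<close>

definition estimate_frobenius :: "nat \<Rightarrow> nat \<Rightarrow> ('v, 'v) prog" where
  "estimate_frobenius n s = do {
     diag \<leftarrow> map_prog (\<lambda>i. Query i i Return) [0..<n];
     tr \<leftarrow> sum_prog diag;
     z \<leftarrow> Const 0 Return;
     nonzero \<leftarrow> Less z tr Return;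
     if \<not> nonzero then Return z
     else do {
       cells \<leftarrow> alias_table diag tr;
       xs \<leftarrow> map_prog (\<lambda>_. trial diag cells) [0..<s];
       tot \<leftarrow> sum_prog xs;
       m \<leftarrow> Const (real s) Return;
       mean \<leftarrow> Arith Divide tot m Return;
       tr2 \<leftarrow> Arith Times tr tr Return;
       Arith Times tr2 mean Return
     }
   }"

end

theory Submission
  imports Defs
begin

text \<open>
  For a psd matrix \<open>A\<close> every trial \<open>X\<close> lies in \<open>[0, 1]\<close>, since each principal 2-by-2 minor is
  nonnegative, and the sampling weights cancel the denominator of \<open>X\<close>, so that \<open>X\<close> has mean
  \<open>\<mu> = (frobenius_norm A)\<^sup>2 / (mat_trace A)\<^sup>2\<close>. By Cauchy--Schwarz on the diagonal, \<open>\<mu> \<ge> 1 / n\<close>;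
  hence the multiplicative Chernoff bound \<open>2 exp (- s \<mu> \<epsilon>\<^sup>2 / 3)\<close> is at most \<open>\<delta>\<close> for the prescribed
  number \<open>s\<close> of trials.

  The program samples exactly from the diagonal distribution because the alias table preserves, for
  each point, the sum of the mass already placed in cells and the mass still to be distributed. The
  total remaining mass always equals the number of remaining items, so as soon as one of the two
  lists is exhausted, all remaining masses are 1. The costs are linear in \<open>n + s\<close>, and a bound
  \<open>\<delta> \<le> \<delta>\<^sub>0 < 1\<close> makes \<open>ln (2 / \<delta>)\<close> and 1 at most constant multiples of \<open>ln (1 / \<delta>)\<close>.
\<close>

section \<open>Results and costs of programs\<close>

text \<open>Both the output laws and the cost bounds rest on this: sequential composition adds the
  counters, and the continuation depends on the first part only through its result.\<close>

lemma run_bind_prog: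
  "run A (bind_prog p f) =
     bind_pmf (run A p) (\<lambda>(x, q, t). map_pmf (\<lambda>(y, q', t'). (y, q + q', t + t')) (run A (f x)))"
  by (induction p)
    (simp_all add: bind_return_pmf bind_map_pmf map_bind_pmf bind_assoc_pmf pmf.map_comp o_def
      case_prod_unfold)

text \<open>Forgetting the counters gives a homomorphism from programs to the monad of
  distributions, so that the simplifier can evaluate a program to its output law.\<close>

definition result :: "real mat \<Rightarrow> (real, 'a) prog \<Rightarrow> 'a pmf" where
  "result A p = map_pmf fst (run A p)"

lemma result_simps [simp]:
  "result A (Return r) = return_pmf r"
  "result A (Query i j k) = result A (k (A $$ (i, j)))"
  "result A (Const c k) = result A (k c)"
  "result A (Arith f x y k) = result A (k (arith f x y))"
  "result A (Less x y k') = result A (k' (x < y))"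
  "result A (Uniform m k'') = bind_pmf (pmf_of_set {..<m}) (\<lambda>i. result A (k'' i))"
  "result A (Coin x k') = bind_pmf (bernoulli_pmf x) (\<lambda>b. result A (k' b))"
  unfolding result_def
  by (simp_all add: pmf.map_comp map_bind_pmf o_def case_prod_unfold)

lemma result_bind_prog [simp]:
  "result A (bind_prog p f) = bind_pmf (result A p) (\<lambda>x. result A (f x))"
  unfolding result_def run_bind_prog
  by (simp add: map_bind_pmf bind_map_pmf pmf.map_comp o_def case_prod_unfold)

text \<open>Repeated runs of one program share no randomness; the independence of the trials comes
  from here.\<close>

lemma result_map_prog_const:
  "result A (map_prog (\<lambda>_. p) xs) = replicate_pmf (length xs) (result A p)"
  by (induction xs) simp_all

lemma result_map_prog_return:
  assumes "\<And>x. x \<in> set xs \<Longrightarrow> result A (f x) = return_pmf (g x)"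
  shows "result A (map_prog f xs) = return_pmf (map g xs)"
  using assms by (induction xs) (simp_all add: bind_return_pmf)

lemma result_sum_prog [simp]: "result A (sum_prog xs) = return_pmf (sum_list xs)"
  by (induction xs) (simp_all add: bind_return_pmf)

text \<open>The bounds concern every outcome in the support, not the average. The postcondition
  \<open>P\<close> carries list lengths forward, since later costs depend on lists computed
  earlier.\<close>

definition cost_le :: "real mat \<Rightarrow> (real, 'a) prog \<Rightarrow> nat \<Rightarrow> nat \<Rightarrow> ('a \<Rightarrow> bool) \<Rightarrow> bool" where
  "cost_le A p Q T P \<longleftrightarrow> (\<forall>(x, q, t) \<in> set_pmf (run A p). q \<le> Q \<and> t \<le> T \<and> P x)"

lemma cost_le_simps [simp]:
  "cost_le A (Return r) Q T P \<longleftrightarrow> P r"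
  "cost_le A (Query i j k) Q T P \<longleftrightarrow> Q > 0 \<and> cost_le A (k (A $$ (i, j))) (Q - 1) T P"
  "cost_le A (Const u k) Q T P \<longleftrightarrow> T > 0 \<and> cost_le A (k u) Q (T - 1) P"
  "cost_le A (Arith f x y k) Q T P \<longleftrightarrow> T > 0 \<and> cost_le A (k (arith f x y)) Q (T - 1) P"
  "cost_le A (Less x y k') Q T P \<longleftrightarrow> T > 0 \<and> cost_le A (k' (x < y)) Q (T - 1) P"
proof -
  \<comment> \<open>The support of a pmf is nonempty, so a conjunct independent of the outcome can
    leave the quantifier.\<close>
  have *: "(\<forall>z \<in> set_pmf M. c > 0 \<and> R z) \<longleftrightarrow> c > 0 \<and> (\<forall>z \<in> set_pmf M. R z)"
    for M :: "('a \<times> nat \<times> nat) pmf" and c :: nat and R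
    using set_pmf_not_empty[of M] by blast
  have Suc_le: "Suc a \<le> b \<longleftrightarrow> 0 < b \<and> a \<le> b - 1" for a b
    by auto
  show
    "cost_le A (Return r) Q T P \<longleftrightarrow> P r"
    "cost_le A (Query i j k) Q T P \<longleftrightarrow> Q > 0 \<and> cost_le A (k (A $$ (i, j))) (Q - 1) T P"
    "cost_le A (Const u k) Q T P \<longleftrightarrow> T > 0 \<and> cost_le A (k u) Q (T - 1) P"
    "cost_le A (Arith f x y k) Q T P \<longleftrightarrow> T > 0 \<and> cost_le A (k (arith f x y)) Q (T - 1) P"
    "cost_le A (Less x y k') Q T P \<longleftrightarrow> T > 0 \<and> cost_le A (k' (x < y)) Q (T - 1) P"
    unfolding cost_le_def
    by (simp_all add: case_prod_unfold Suc_le conj_assoc conj_left_commute[of "_ \<le> _" "0 < _"] *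
        del: Suc_le_eq Suc_le_lessD)
qed

lemma cost_le_Uniform [intro]:
  "T > 0 \<Longrightarrow> (\<And>i. cost_le A (k i) Q (T - 1) P) \<Longrightarrow> cost_le A (Uniform m k) Q T P"
  unfolding cost_le_def by fastforce

lemma cost_le_Coin [intro]:
  "T > 0 \<Longrightarrow> (\<And>b. cost_le A (k b) Q (T - 1) P) \<Longrightarrow> cost_le A (Coin p k) Q T P"
  unfolding cost_le_def by fastforce

lemma cost_le_bind_prog:
  assumes "cost_le A p Q T R" "\<And>x. R x \<Longrightarrow> cost_le A (f x) Q' T' P"
    and "Q + Q' \<le> Q''" "T + T' \<le> T''"
  shows "cost_le A (bind_prog p f) Q'' T'' P"
  using assms unfolding cost_le_def run_bind_prog by (fastforce simp: case_prod_unfold)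

lemma cost_le_map_prog:
  assumes "\<And>x. x \<in> set xs \<Longrightarrow> cost_le A (f x) Q T (\<lambda>_. True)"
  shows "cost_le A (map_prog f xs) (length xs * Q) (length xs * T) (\<lambda>ys. length ys = length xs)"
  using assms
proof (induction xs)
  case (Cons x xs)
  have "cost_le A (map_prog f xs \<bind> (\<lambda>ys. Return (y # ys))) (length xs * Q) (length xs * T)
          (\<lambda>ys. length ys = Suc (length xs))" for y
    by (rule cost_le_bind_prog[OF Cons.IH]) (use Cons.prems in auto)
  then show ?case
    by (auto intro!: cost_le_bind_prog[OF Cons.prems])
qed simp

lemma cost_le_sum_prog: "cost_le A (sum_prog xs) 0 (Suc (length xs)) (\<lambda>_. True)"
  by (induction xs) (auto intro: cost_le_bind_prog)

text \<open>Each recursive call costs three operations and finishes one item. The other item may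
  change lists, hence the induction on the total length.\<close>

lemma cost_le_alias_cells:
  "cost_le A (alias_cells c ss ls) 0 (3 * (length ss + length ls)) (\<lambda>_. True)"
proof (induction "length ss + length ls" arbitrary: ss ls rule: less_induct)
  case less
  show ?case
  proof (cases "ss = [] \<or> ls = []")
    case True
    then show ?thesis
      by (cases ss; cases ls) auto
  next
    case False
    then obtain i p ss' j q ls' where eq: "ss = (i, p) # ss'" "ls = (j, q) # ls'"
      by (metis list.exhaust surj_pair)
    have "cost_le A (alias_cells c ((j, r) # ss') ls') 0 (3 * (Suc (length ss' + length ls'))) (\<lambda>_. True)"
      "cost_le A (alias_cells c ss' ((j, r) # ls')) 0 (3 * (Suc (length ss' + length ls'))) (\<lambda>_. True)" for r
      using less[of "(j, r) # ss'" ls'] less[of ss' "(j, r) # ls'"] by (simp_all add: eq)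
    then show ?thesis
      by (auto simp: eq intro!: cost_le_bind_prog)
  qed
qed

text \<open>Two constants, three operations per weight to scale and classify it, and three per item
  in \<open>alias_cells\<close>; the two filtered lists together hold one item per weight.\<close>

lemma cost_le_alias_table: "cost_le A (alias_table ws tot) 0 (6 * length ws + 2) (\<lambda>_. True)"
proof -
  let ?f = "\<lambda>i. Arith Divide (ws ! i) tot (\<lambda>x. Arith Times (real (length ws)) x
              (\<lambda>p. Less p 1 (\<lambda>small. Return (small, i, p))))"
  let ?rest = "\<lambda>items. alias_cells 1 (map snd (filter fst items)) (map snd (filter (\<lambda>it. \<not> fst it) items))"
  have "cost_le A (map_prog ?f [0..<length ws]) (length [0..<length ws] * 0)
          (length [0..<length ws] * 3) (\<lambda>ys. length ys = length [0..<length ws])"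
    by (rule cost_le_map_prog) simp
  moreover have "cost_le A (?rest items) 0 (3 * length items) (\<lambda>_. True)" for items :: "(bool \<times> nat \<times> real) list"
    using cost_le_alias_cells[of A 1 "map snd (filter fst items)" "map snd (filter (\<lambda>it. \<not> fst it) items)"]
    by (simp add: sum_length_filter_compl)
  ultimately have "cost_le A (map_prog ?f [0..<length ws] \<bind> ?rest) 0 (6 * length ws) (\<lambda>_. True)"
    by (elim cost_le_bind_prog[where Q' = 0 and T' = "3 * length ws"]) (simp_all, metis)
  then show ?thesis
    by (simp add: alias_table_def)
qed

lemma cost_le_draw: "cost_le A (draw cells) 0 2 (\<lambda>_. True)"
  by (auto simp: draw_def Let_def case_prod_unfold intro!: cost_le_Uniform cost_le_Coin)

lemma cost_le_trial: "cost_le A (trial diag cells) 1 7 (\<lambda>_. True)"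
  unfolding trial_def
  by (rule cost_le_bind_prog[OF cost_le_draw cost_le_bind_prog[OF cost_le_draw,
      where Q' = 1 and T' = 3]]) auto

text \<open>Queries: \<open>n\<close> for the diagonal and one per trial. Operations:
  \<open>n + 3\<close> to sum the diagonal and test the trace, \<open>6 * n + 2\<close> for the
  table, \<open>7 * s\<close> for the trials, \<open>s + 1\<close> for their sum, and 4 to
  finish.\<close>

lemma cost_le_estimate_frobenius:
  "cost_le A (estimate_frobenius n s) (n + s) (7 * n + 8 * s + 10) (\<lambda>_. True)"
proof -
  have read: "cost_le A (map_prog (\<lambda>i. Query i i Return) [0..<n]) n 0 (\<lambda>ys. length ys = n)"
    using cost_le_map_prog[of "[0..<n]" A "\<lambda>i. Query i i Return" 1 0] by simp
  have trials: "cost_le A (map_prog (\<lambda>_. trial diag cells) [0..<s]) s (7 * s) (\<lambda>ys. length ys = s)"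
    for diag :: "real list" and cells
    using cost_le_map_prog[of "[0..<s]" A "\<lambda>_. trial diag cells", OF cost_le_trial]
    by (simp add: mult.commute)
  have sum: "cost_le A (sum_prog xs) 0 (Suc k) (\<lambda>_. True)" if "length xs = k" for xs k
    using cost_le_sum_prog[of A xs] that by simp
  have sample: "cost_le A (do {
       cells \<leftarrow> alias_table diag tr;
       xs \<leftarrow> map_prog (\<lambda>_. trial diag cells) [0..<s];
       tot \<leftarrow> sum_prog xs;
       m \<leftarrow> Const (real s) Return;
       mean \<leftarrow> Arith Divide tot m Return;
       tr2 \<leftarrow> Arith Times tr tr Return;
       Arith Times tr2 mean Return
     }) s (6 * n + 8 * s + 7) (\<lambda>_. True)" if "length diag = n" for diag tr
    by (rule cost_le_bind_prog[OF cost_le_alias_table cost_le_bind_prog[OF trials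
          cost_le_bind_prog[OF sum, where Q' = 0 and T' = 4 and Q'' = 0 and T'' = "s + 5"],
          where Q'' = s and T'' = "8 * s + 5"]]) (use that in auto)
  show ?thesis
    unfolding estimate_frobenius_def
    by (rule cost_le_bind_prog[OF read cost_le_bind_prog[OF sum, where Q' = s and T' = "6 * n + 8 * s + 9" and
          Q'' = s and T'' = "7 * n + 8 * s + 10"]])
      (use sample in \<open>auto simp: add.commute add.left_commute\<close>)
qed

section \<open>Multiplicative Chernoff bound\<close>

text \<open>Independence makes the moment generating function of a sum factorize. With nonnegative
  integrals no integrability conditions arise.\<close>

lemma nn_integral_exp_sum_list_replicate_pmf:
  fixes p :: "real pmf"
  shows "(\<integral>\<^sup>+xs. ennreal (exp (t * sum_list xs)) \<partial>replicate_pmf s p) =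
    (\<integral>\<^sup>+x. ennreal (exp (t * x)) \<partial>p) ^ s"
proof (induction s)
  case (Suc s)
  show ?case
    by (simp add: distrib_left exp_add ennreal_mult nn_integral_cmult nn_integral_multc Suc)
qed simp

text \<open>By convexity the exponential lies below its chord between 0 and
  \<open>t\<close>.\<close>

lemma exp_mult_le_chord:
  fixes t x :: real
  assumes "x \<in> {0..1}"
  shows "exp (t * x) \<le> 1 + x * (exp t - 1)"
proof -
  have "exp ((1 - x) *\<^sub>R 0 + x *\<^sub>R t) \<le> (1 - x) * exp 0 + x * exp t"
    by (rule convex_onD[OF exp_convex]) (use assms in auto)
  then show ?thesis
    by (simp add: algebra_simps)
qed

text \<open>The chord is affine in \<open>x\<close>, so its integral involves only the mean; then
  \<open>1 + y \<le> exp y\<close>.\<close>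

lemma nn_integral_exp_le:
  fixes p :: "real pmf"
  assumes "set_pmf p \<subseteq> {0..1}"
  shows "(\<integral>\<^sup>+x. ennreal (exp (t * x)) \<partial>p) \<le>
    ennreal (exp (measure_pmf.expectation p (\<lambda>x. x) * (exp t - 1)))"
proof -
  have int: "integrable p (\<lambda>x. x)"
    by (rule measure_pmf.integrable_const_bound[where B = 1])
      (use assms in \<open>auto simp: AE_measure_pmf_iff\<close>)
  have "(\<integral>\<^sup>+x. ennreal (exp (t * x)) \<partial>p) \<le> (\<integral>\<^sup>+x. ennreal (1 + x * (exp t - 1)) \<partial>p)"
    by (intro nn_integral_mono_AE)
      (use assms in \<open>auto simp: AE_measure_pmf_iff intro!: ennreal_leI exp_mult_le_chord\<close>)
  also have "\<dots> = ennreal (\<integral>x. 1 + x * (exp t - 1) \<partial>p)"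
  proof (rule nn_integral_eq_integral)
    \<comment> \<open>This holds for negative \<open>t\<close> too, because the chord dominates an
      exponential.\<close>
    have "0 \<le> 1 + x * (exp t - 1)" if "x \<in> set_pmf p" for x
      using exp_mult_le_chord[of x t] assms that exp_ge_zero[of "t * x"] by (meson order_trans subsetD)
    then show "AE x in p. 0 \<le> 1 + x * (exp t - 1)"
      by (simp add: AE_measure_pmf_iff)
  qed (use int in auto)
  also have "(\<integral>x. 1 + x * (exp t - 1) \<partial>p) = 1 + measure_pmf.expectation p (\<lambda>x. x) * (exp t - 1)"
    using int by simp
  also have "\<dots> \<le> exp (measure_pmf.expectation p (\<lambda>x. x) * (exp t - 1))"
    by (rule exp_ge_add_one_self)
  finally show ?thesis
    by (simp add: ennreal_leI)
qed

text \<open>Markov's inequality for the exponential. Phrasing the event with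
  \<open>t * sum_list xs\<close> covers both tails: positive \<open>t\<close> gives the upper one,
  negative \<open>t\<close> the lower one.\<close>

lemma prob_exponential_tail:
  fixes p :: "real pmf"
  assumes "set_pmf p \<subseteq> {0..1}"
  defines "\<mu> \<equiv> measure_pmf.expectation p (\<lambda>x. x)"
  shows "measure_pmf.prob (replicate_pmf s p) {xs. c \<le> t * sum_list xs} \<le> exp (real s * \<mu> * (exp t - 1) - c)"
proof -
  let ?E = "{xs. c \<le> t * sum_list xs}"
  have "emeasure (replicate_pmf s p) ?E = (\<integral>\<^sup>+xs. indicator ?E xs \<partial>replicate_pmf s p)"
    by simp
  also have "\<dots> \<le> (\<integral>\<^sup>+xs. ennreal (exp (- c)) * ennreal (exp (t * sum_list xs)) \<partial>replicate_pmf s p)"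
    by (intro nn_integral_mono)
      (auto simp: indicator_def ennreal_mult[symmetric] exp_add[symmetric])
  also have "\<dots> = ennreal (exp (- c)) * (\<integral>\<^sup>+x. ennreal (exp (t * x)) \<partial>p) ^ s"
    by (simp add: nn_integral_cmult nn_integral_exp_sum_list_replicate_pmf)
  also have "\<dots> \<le> ennreal (exp (- c)) * ennreal (exp (\<mu> * (exp t - 1))) ^ s"
    unfolding \<mu>_def by (intro mult_left_mono power_mono nn_integral_exp_le assms) auto
  also have "\<dots> = ennreal (exp (real s * \<mu> * (exp t - 1) - c))"
    by (simp add: ennreal_power ennreal_mult[symmetric] exp_of_nat_mult[symmetric] exp_add[symmetric]
        algebra_simps)
  finally show ?thesis
    by (simp add: measure_pmf.emeasure_eq_measure)
qed

text \<open>The parameters \<open>ln (1 + \<epsilon>)\<close> and \<open>ln (1 - \<epsilon>)\<close>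
  minimize the two tail exponents. Both minima are at most
  \<open>- (s * \<mu> * \<epsilon>\<^sup>2 / 3)\<close>, and a union bound adds the tails.\<close>

lemma chernoff_two_sided:
  fixes p :: "real pmf" and \<epsilon> :: real
  assumes p: "set_pmf p \<subseteq> {0..1}" and \<epsilon>: "\<epsilon> \<in> {0<..<1}"
  defines "\<mu> \<equiv> measure_pmf.expectation p (\<lambda>x. x)"
  shows "measure_pmf.prob (replicate_pmf s p)
      {xs. (1 - \<epsilon>) * (real s * \<mu>) \<le> sum_list xs \<and> sum_list xs \<le> (1 + \<epsilon>) * (real s * \<mu>)}
    \<ge> 1 - 2 * exp (- (real s * \<mu> * \<epsilon>\<^sup>2 / 3))" (is "measure_pmf.prob ?M ?good \<ge> _")
proof -
  let ?up = "{xs. ln (1 + \<epsilon>) * ((1 + \<epsilon>) * (real s * \<mu>)) \<le> ln (1 + \<epsilon>) * sum_list xs}"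
  \<comment> \<open>Since \<open>ln (1 - \<epsilon>)\<close> is negative, this is the event that the
    sum is at most \<open>(1 - \<epsilon>) * (s * \<mu>)\<close>.\<close>
  let ?lo = "{xs. ln (1 - \<epsilon>) * ((1 - \<epsilon>) * (real s * \<mu>)) \<le> ln (1 - \<epsilon>) * sum_list xs}"
  have \<mu>: "\<mu> \<ge> 0"
    unfolding \<mu>_def using p by (intro integral_nonneg_AE) (auto simp: AE_measure_pmf_iff)
  then have m: "real s * \<mu> \<ge> 0"
    by simp
  \<comment> \<open>Midpoint rule for the convex function 1/x on the interval from 1 to
    \<open>1 + \<epsilon>\<close>.\<close>
  have "2 * \<epsilon> / (2 + \<epsilon>) \<le> ln (1 + \<epsilon>)"
    using ln_inverse_approx_ge[of 1 "1 + \<epsilon>"] \<epsilon> by simp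
  then have "(1 + \<epsilon>) * (2 * \<epsilon> / (2 + \<epsilon>)) \<le> (1 + \<epsilon>) * ln (1 + \<epsilon>)"
    using \<epsilon> by (intro mult_left_mono) auto
  moreover have "\<epsilon> + \<epsilon>\<^sup>2 / 3 \<le> (1 + \<epsilon>) * (2 * \<epsilon> / (2 + \<epsilon>))"
  proof -
    \<comment> \<open>The subtracted term vanishes at \<open>\<epsilon> = 1\<close>, so 1/3 is the
      largest constant that this bound on the logarithm yields on the whole interval.\<close>
    have "(\<epsilon> + \<epsilon>\<^sup>2 / 3) * (2 + \<epsilon>) = (1 + \<epsilon>) * (2 * \<epsilon>) - \<epsilon>\<^sup>2 * (1 - \<epsilon>) / 3"
      by (simp add: power2_eq_square field_simps)
    also have "\<dots> \<le> (1 + \<epsilon>) * (2 * \<epsilon>)"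
      using \<epsilon> by simp
    finally show ?thesis
      using \<epsilon> by (simp add: pos_le_divide_eq)
  qed
  ultimately have up: "\<epsilon> - (1 + \<epsilon>) * ln (1 + \<epsilon>) \<le> - (\<epsilon>\<^sup>2 / 3)"
    by linarith
  \<comment> \<open>Trapezoidal rule for 1/x on the interval from \<open>1 - \<epsilon>\<close> to
    1. It gives the better constant 1/2, which is then weakened to 1/3.\<close>
  have "- ln (1 - \<epsilon>) \<le> \<epsilon> * (1 / (1 - \<epsilon>) + 1) / 2"
    using ln_inverse_approx_le[of "1 - \<epsilon>" \<epsilon>] \<epsilon> by (simp add: inverse_eq_divide)
  then have "- (\<epsilon> * (1 / (1 - \<epsilon>) + 1) / 2) \<le> ln (1 - \<epsilon>)"
    by (simp only: minus_le_iff)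
  then have "(1 - \<epsilon>) * ln (1 - \<epsilon>) \<ge> (1 - \<epsilon>) * - (\<epsilon> * (1 / (1 - \<epsilon>) + 1) / 2)"
    using \<epsilon> by (intro mult_left_mono) auto
  moreover have "(1 - \<epsilon>) * - (\<epsilon> * (1 / (1 - \<epsilon>) + 1) / 2) = - \<epsilon> + \<epsilon>\<^sup>2 / 2"
    using \<epsilon> by (simp add: field_simps power2_eq_square)
  moreover have "\<epsilon>\<^sup>2 \<ge> 0"
    by simp
  ultimately have lo: "- \<epsilon> - (1 - \<epsilon>) * ln (1 - \<epsilon>) \<le> - (\<epsilon>\<^sup>2 / 3)"
    by linarith
  have "measure_pmf.prob ?M ?up \<le> exp (real s * \<mu> * (\<epsilon> - (1 + \<epsilon>) * ln (1 + \<epsilon>)))"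
    using prob_exponential_tail[OF p, of s "ln (1 + \<epsilon>) * ((1 + \<epsilon>) * (real s * \<mu>))" "ln (1 + \<epsilon>)"] \<epsilon>
    by (simp add: \<mu>_def algebra_simps)
  also have "\<dots> \<le> exp (real s * \<mu> * - (\<epsilon>\<^sup>2 / 3))"
    using mult_left_mono[OF up m] by simp
  finally have pup: "measure_pmf.prob ?M ?up \<le> exp (- (real s * \<mu> * \<epsilon>\<^sup>2 / 3))"
    by simp
  have "measure_pmf.prob ?M ?lo \<le> exp (real s * \<mu> * (- \<epsilon> - (1 - \<epsilon>) * ln (1 - \<epsilon>)))"
    using prob_exponential_tail[OF p, of s "ln (1 - \<epsilon>) * ((1 - \<epsilon>) * (real s * \<mu>))" "ln (1 - \<epsilon>)"] \<epsilon>
    by (simp add: \<mu>_def algebra_simps)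
  also have "\<dots> \<le> exp (real s * \<mu> * - (\<epsilon>\<^sup>2 / 3))"
    using mult_left_mono[OF lo m] by simp
  finally have plo: "measure_pmf.prob ?M ?lo \<le> exp (- (real s * \<mu> * \<epsilon>\<^sup>2 / 3))"
    by simp
  have "1 - measure_pmf.prob ?M ?good = measure_pmf.prob ?M (- ?good)"
    using measure_pmf.prob_compl[of ?good ?M] by (simp add: Compl_eq_Diff_UNIV)
  also have "\<dots> \<le> measure_pmf.prob ?M (?up \<union> ?lo)"
    using \<epsilon> by (intro measure_pmf.finite_measure_mono)
      (auto simp: mult_le_cancel_left)
  also have "\<dots> \<le> measure_pmf.prob ?M ?up + measure_pmf.prob ?M ?lo"
    by (rule measure_Un_le) auto
  finally show ?thesis
    using pup plo by linarith
qed

section \<open>Positive semidefinite matrices\<close>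

lemma psd_mat_symmetric:
  assumes "psd_mat n A" "i < n" "j < n"
  shows "A $$ (i, j) = A $$ (j, i)"
proof -
  have "transpose_mat A = A" "dim_row A = n" "dim_col A = n"
    using assms(1) by (auto simp: psd_mat_def)
  then show ?thesis
    using assms(2,3) index_transpose_mat(1)[of i A j] by metis
qed

lemma psd_mat_quadratic_form:
  assumes "psd_mat n A"
  shows "(\<Sum>k<n. \<Sum>l<n. x k * (A $$ (k, l) * x l)) \<ge> 0"
proof -
  have "A \<in> carrier_mat n n" "scalar_prod (vec n x) (mult_mat_vec A (vec n x)) \<ge> 0"
    using assms by (auto simp: psd_mat_def)
  then show ?thesis
    by (simp add: scalar_prod_def sum_distrib_left atLeast0LessThan)
qed

lemma psd_mat_diag_nonneg:
  assumes "psd_mat n A" "i < n"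
  shows "A $$ (i, i) \<ge> 0"
proof -
  define x :: "nat \<Rightarrow> real" where "x k = (if k = i then 1 else 0)" for k
  have single: "(\<Sum>k<n. x k * f k) = f i" for f
  proof -
    have "(\<Sum>k<n. x k * f k) = (\<Sum>k<n. if k = i then f k else 0)"
      by (intro sum.cong) (auto simp: x_def)
    then show ?thesis
      using assms(2) by simp
  qed
  have "(\<Sum>l<n. A $$ (k, l) * x l) = A $$ (k, i)" for k
    using single[of "\<lambda>l. A $$ (k, l)"] by (simp add: mult.commute)
  then show ?thesis
    using psd_mat_quadratic_form[OF assms(1), of x] by (simp add: sum_distrib_left[symmetric] single)
qed

text \<open>The quadratic form is evaluated at \<open>a\<close> times the \<open>i\<close>-th plus
  \<open>b\<close> times the \<open>j\<close>-th unit vector.\<close>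

lemma psd_mat_two_point:
  assumes "psd_mat n A" "i < n" "j < n" "i \<noteq> j"
  shows "a\<^sup>2 * A $$ (i, i) + 2 * a * b * A $$ (i, j) + b\<^sup>2 * A $$ (j, j) \<ge> 0"
proof -
  define x where "x k = (if k = i then a else 0) + (if k = j then b else 0)" for k
  have single: "(\<Sum>k<n. x k * f k) = a * f i + b * f j" for f :: "nat \<Rightarrow> real"
  proof -
    have "(\<Sum>k<n. x k * f k) = (\<Sum>k<n. (if k = i then a * f k else 0) + (if k = j then b * f k else 0))"
      by (intro sum.cong) (auto simp: x_def distrib_right)
    then show ?thesis
      using assms by (simp add: sum.distrib)
  qed
  have "(\<Sum>l<n. A $$ (k, l) * x l) = a * A $$ (k, i) + b * A $$ (k, j)" for k
    using single[of "\<lambda>l. A $$ (k, l)"] by (simp add: mult.commute)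
  then have "(\<Sum>k<n. \<Sum>l<n. x k * (A $$ (k, l) * x l)) =
      a * (a * A $$ (i, i) + b * A $$ (i, j)) + b * (a * A $$ (j, i) + b * A $$ (j, j))"
    by (simp add: sum_distrib_left[symmetric] single)
  also have "\<dots> = a\<^sup>2 * A $$ (i, i) + 2 * a * b * A $$ (i, j) + b\<^sup>2 * A $$ (j, j)"
    using psd_mat_symmetric[OF assms(1-3)] by (simp add: algebra_simps power2_eq_square)
  finally show ?thesis
    using psd_mat_quadratic_form[OF assms(1), of x] by simp
qed

lemma psd_mat_entry_square_le:
  assumes "psd_mat n A" "i < n" "j < n"
  shows "(A $$ (i, j))\<^sup>2 \<le> A $$ (i, i) * A $$ (j, j)"
proof (cases "i = j")
  case False
  have pos: "(A $$ (k, l))\<^sup>2 \<le> A $$ (k, k) * A $$ (l, l)"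
    if "k < n" "l < n" "k \<noteq> l" "A $$ (l, l) > 0" for k l
  proof -
    have "A $$ (l, l) * (A $$ (k, k) * A $$ (l, l) - (A $$ (k, l))\<^sup>2) \<ge> 0"
      \<comment> \<open>With these coefficients the form equals \<open>A $$ (l, l)\<close> times the
        2-by-2 minor.\<close>
      using psd_mat_two_point[OF assms(1) that(1-3), of "A $$ (l, l)" "- A $$ (k, l)"]
      by (simp add: algebra_simps power2_eq_square)
    then show ?thesis
      using that(4) by (simp add: zero_le_mult_iff)
  qed
  consider "A $$ (i, i) > 0" | "A $$ (j, j) > 0" | "A $$ (i, i) = 0" "A $$ (j, j) = 0"
    using psd_mat_diag_nonneg[OF assms(1)] assms(2,3) by fastforce
  then show ?thesis
  proof cases
    case 1
    then show ?thesis
      using pos[of j i] False assms psd_mat_symmetric[OF assms] by (simp add: mult.commute)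
  next
    case 2
    then show ?thesis
      using pos[of i j] False assms by simp
  next
    case 3
    then show ?thesis
      \<comment> \<open>With a zero diagonal only the cross term
        \<open>- 2 * (A $$ (i, j))\<^sup>2\<close> remains, and it must be nonnegative.\<close>
      using psd_mat_two_point[OF assms False, of 1 "- A $$ (i, j)"] by (simp add: power2_eq_square)
  qed
qed (simp add: power2_eq_square)

lemma mat_trace_carrier: "A \<in> carrier_mat n n \<Longrightarrow> mat_trace A = (\<Sum>i<n. A $$ (i, i))"
  by (auto simp: mat_trace_def)

lemma frobenius_norm_square:
  "A \<in> carrier_mat n n \<Longrightarrow> (frobenius_norm A)\<^sup>2 = (\<Sum>i<n. \<Sum>j<n. (A $$ (i, j))\<^sup>2)"
  by (auto simp: frobenius_norm_def intro!: sum_nonneg)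

text \<open>Zero trace forces a zero diagonal, and the 2-by-2 minors then force every entry to be
  zero. Hence the trace test in the program detects exactly the zero matrix.\<close>

lemma psd_mat_trace_pos:
  assumes "psd_mat n A" "A \<noteq> 0\<^sub>m n n"
  shows "mat_trace A > 0"
proof (rule ccontr)
  have A: "A \<in> carrier_mat n n"
    using assms by (simp add: psd_mat_def)
  assume "\<not> mat_trace A > 0"
  moreover have "mat_trace A \<ge> 0"
    using psd_mat_diag_nonneg[OF assms(1)] by (auto simp: mat_trace_carrier[OF A] intro: sum_nonneg)
  ultimately have "(\<Sum>i<n. A $$ (i, i)) = 0"
    by (simp add: mat_trace_carrier[OF A])
  then have diag: "A $$ (i, i) = 0" if "i < n" for i
    using psd_mat_diag_nonneg[OF assms(1)] that by (subst (asm) sum_nonneg_eq_0_iff) auto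
  have "A $$ (i, j) = 0" if "i < n" "j < n" for i j
    using psd_mat_entry_square_le[OF assms(1) that] diag that by simp
  then have "A = 0\<^sub>m n n"
    using A by (intro eq_matI) auto
  then show False
    using assms(2) by simp
qed

lemma psd_mat_trace_square_le:
  assumes "psd_mat n A"
  shows "(mat_trace A)\<^sup>2 \<le> real n * (frobenius_norm A)\<^sup>2"
proof -
  have A: "A \<in> carrier_mat n n"
    using assms by (simp add: psd_mat_def)
  have "(\<Sum>i<n. A $$ (i, i) * 1)\<^sup>2 \<le> (\<Sum>i<n. (A $$ (i, i))\<^sup>2) * (\<Sum>i<n. 1\<^sup>2)"
    by (rule Cauchy_Schwarz_ineq_sum)
  \<comment> \<open>The diagonal entries are among the summands of the Frobenius norm.\<close>
  moreover have "(\<Sum>i<n. (A $$ (i, i))\<^sup>2) \<le> (\<Sum>i<n. \<Sum>j<n. (A $$ (i, j))\<^sup>2)"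
    by (intro sum_mono member_le_sum) auto
  ultimately have "(mat_trace A)\<^sup>2 \<le> (frobenius_norm A)\<^sup>2 * real n"
    unfolding mat_trace_carrier[OF A] frobenius_norm_square[OF A]
    by (auto elim!: order_trans intro: mult_right_mono)
  then show ?thesis
    by (simp add: mult.commute)
qed

section \<open>Law of a trial\<close>

lemma pmf_diag_pmf:
  assumes "psd_mat n A" "A \<noteq> 0\<^sub>m n n"
  shows "pmf (diag_pmf A) i = (if i < n then A $$ (i, i) / mat_trace A else 0)"
proof -
  have A: "A \<in> carrier_mat n n"
    using assms by (simp add: psd_mat_def)
  have tr: "mat_trace A > 0"
    by (rule psd_mat_trace_pos[OF assms])
  let ?f = "\<lambda>i. if i < n then A $$ (i, i) / mat_trace A else 0"
  have nonneg: "?f i \<ge> 0" for i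
    using psd_mat_diag_nonneg[OF assms(1)] tr by simp
  have "(\<integral>\<^sup>+i. ennreal (?f i) \<partial>count_space UNIV) = (\<Sum>i<n. ennreal (?f i))"
    by (rule nn_integral_count_space') auto
  also have "\<dots> = ennreal (\<Sum>i<n. ?f i)"
    by (intro sum_ennreal nonneg)
  also have "(\<Sum>i<n. ?f i) = (\<Sum>i<n. A $$ (i, i)) / mat_trace A"
    by (simp add: sum_divide_distrib)
  finally have "(\<integral>\<^sup>+i. ennreal (?f i) \<partial>count_space UNIV) = 1"
    using tr by (simp add: mat_trace_carrier[OF A])
  then have "pmf (embed_pmf ?f) i = ?f i"
    by (intro pmf_embed_pmf nonneg)
  then show ?thesis
    using A by (simp add: diag_pmf_def)
qed

lemma set_pmf_diag_pmf:
  assumes "psd_mat n A" "A \<noteq> 0\<^sub>m n n"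
  shows "set_pmf (diag_pmf A) \<subseteq> {..<n}"
  by (auto simp: set_pmf_iff pmf_diag_pmf[OF assms] split: if_splits)

lemma set_pmf_trial_pmf:
  assumes "psd_mat n A" "A \<noteq> 0\<^sub>m n n"
  shows "set_pmf (trial_pmf A) \<subseteq> {0..1}"
proof -
  have "a / b \<in> {0..1}" if "0 \<le> a" "a \<le> b" for a b :: real
    using that by (auto simp: divide_le_eq_1)
  then have "(A $$ (i, j))\<^sup>2 / (A $$ (i, i) * A $$ (j, j)) \<in> {0..1}" if "i < n" "j < n" for i j
    using psd_mat_entry_square_le[OF assms(1) that] by (meson zero_le_power2)
  then show ?thesis
    using set_pmf_diag_pmf[OF assms] by (auto simp: trial_pmf_def simp del: atLeastAtMost_iff)
qed

lemma expectation_trial_pmf: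
  assumes "psd_mat n A" "A \<noteq> 0\<^sub>m n n"
  shows "measure_pmf.expectation (trial_pmf A) (\<lambda>x. x) = (frobenius_norm A)\<^sup>2 / (mat_trace A)\<^sup>2"
proof -
  have A: "A \<in> carrier_mat n n"
    using assms by (simp add: psd_mat_def)
  let ?g = "\<lambda>i j. (A $$ (i, j))\<^sup>2 / (A $$ (i, i) * A $$ (j, j))"
  have "trial_pmf A = map_pmf (\<lambda>(i, j). ?g i j) (pair_pmf (diag_pmf A) (diag_pmf A))"
    by (simp add: trial_pmf_def pair_pmf_def map_bind_pmf)
  then have "measure_pmf.expectation (trial_pmf A) (\<lambda>x. x) =
      measure_pmf.expectation (pair_pmf (diag_pmf A) (diag_pmf A)) (\<lambda>z. ?g (fst z) (snd z))"
    by (simp add: case_prod_unfold)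
  also have "\<dots> = (\<Sum>z\<in>{..<n} \<times> {..<n}. ?g (fst z) (snd z) * pmf (pair_pmf (diag_pmf A) (diag_pmf A)) z)"
    by (rule integral_measure_pmf_real) (use set_pmf_diag_pmf[OF assms] in auto)
  also have "\<dots> = (\<Sum>i<n. \<Sum>j<n. (A $$ (i, j))\<^sup>2 / (mat_trace A)\<^sup>2)"
    unfolding sum.cartesian_product
  proof (rule sum.cong, goal_cases)
    case (2 z)
    then obtain i j where z: "z = (i, j)" "i < n" "j < n"
      by auto
    show ?case
    proof (cases "A $$ (i, i) * A $$ (j, j) = 0")
      \<comment> \<open>Division by zero yields 0 on the left. The minor bound makes the entry
        itself 0, so pairs that are never sampled contribute nothing to the Frobenius norm.\<close>
      case True
      then have "A $$ (i, j) = 0"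
        using psd_mat_entry_square_le[OF assms(1) z(2,3)] by (simp only: True) simp
      then show ?thesis
        by (simp add: z)
    next
      case False
      then show ?thesis
        using z by (simp add: pmf_pair pmf_diag_pmf[OF assms] power2_eq_square)
    qed
  qed simp
  finally show ?thesis
    by (simp add: frobenius_norm_square[OF A] sum_divide_distrib)
qed

section \<open>Correctness of the alias method\<close>

definition item_mass :: "(nat \<times> real) list \<Rightarrow> nat \<Rightarrow> real" where
  "item_mass xs k = (\<Sum>(i, p)\<leftarrow>xs. of_bool (i = k) * p)"

text \<open>The two contributions are added so that a final cell with \<open>i = j\<close> gives its
  whole unit to one point.\<close>

definition cell_mass :: "(nat \<times> real \<times> nat) list \<Rightarrow> nat \<Rightarrow> real" where
  "cell_mass cells k = (\<Sum>(i, p, j)\<leftarrow>cells. of_bool (i = k) * p + of_bool (j = k) * (1 - p))"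

lemma sum_list_filter_partition:
  fixes f :: "'a \<Rightarrow> 'b :: comm_monoid_add"
  shows "sum_list (map f (filter P xs)) + sum_list (map f (filter (\<lambda>x. \<not> P x) xs)) = sum_list (map f xs)"
  by (induction xs) (simp_all add: ac_simps)

lemma sum_list_eq_length_ge_1:
  fixes xs :: "real list"
  assumes "\<forall>x \<in> set xs. 1 \<le> x" "sum_list xs = length xs"
  shows "\<forall>x \<in> set xs. x = 1"
proof -
  have "sum_list (map (\<lambda>x. x - 1) xs) = 0"
    using assms(2) by (simp add: sum_list_subtractf sum_list_triv)
  then show ?thesis
    using assms(1) by (subst (asm) sum_list_nonneg_eq_0_iff) auto
qed

text \<open>Items of mass below 1 cannot have mean 1, so the list of small items is never the only
  one left.\<close>

lemma sum_list_eq_length_less_1: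
  fixes xs :: "real list"
  assumes "\<forall>x \<in> set xs. x < 1" "sum_list xs = length xs"
  shows "xs = []"
proof -
  have "sum_list (map (\<lambda>x. 1 - x) xs) = 0"
    using assms(2) by (simp add: sum_list_subtractf sum_list_triv)
  then have "\<forall>x \<in> set xs. x = 1"
    using assms(1) by (subst (asm) sum_list_nonneg_eq_0_iff) auto
  then show ?thesis
    using assms(1) by (cases xs) auto
qed

text \<open>A step removes one item and one unit of mass, so the remaining masses keep mean 1. Point
  \<open>i\<close> spends its mass \<open>p\<close>, and \<open>j\<close> supplies the missing
  \<open>1 - p\<close>.\<close>

lemma result_alias_cells:
  assumes "\<forall>(i, p) \<in> set ss. 0 \<le> p \<and> p < 1" "\<forall>(j, q) \<in> set ls. 1 \<le> q"
    and "sum_list (map snd ss) + sum_list (map snd ls) = real (length ss + length ls)"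
  shows "\<exists>cells. result A (alias_cells 1 ss ls) = return_pmf cells \<and>
    length cells = length ss + length ls \<and> (\<forall>(i, p, j) \<in> set cells. 0 \<le> p \<and> p \<le> 1) \<and>
    (\<forall>k. cell_mass cells k = item_mass ss k + item_mass ls k)"
  using assms
proof (induction "length ss + length ls" arbitrary: ss ls rule: less_induct)
  case less
  have unit: ?case if "\<forall>x \<in> set (ss @ ls). snd x = 1" "ss = [] \<or> ls = []"
  proof -
    let ?cells = "map (\<lambda>(i, _). (i, 1, i)) (ss @ ls) :: (nat \<times> real \<times> nat) list"
    have "result A (alias_cells 1 ss ls) = return_pmf ?cells"
      using that(2) by (cases ss; cases ls) auto
    moreover have "cell_mass ?cells k = item_mass (ss @ ls) k" for k
      unfolding cell_mass_def item_mass_def map_map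
      by (intro arg_cong[of _ _ sum_list] map_cong refl) (simp add: case_prod_unfold that(1))
    ultimately show ?thesis
      by (auto simp: item_mass_def)
  qed
  consider "ss = []" | "ls = []" | "ss \<noteq> []" "ls \<noteq> []"
    by blast
  then show ?case
  proof cases
    case 1
    have "\<forall>q \<in> set (map snd ls). q = 1"
      by (rule sum_list_eq_length_ge_1) (use less.prems 1 in auto)
    then show ?thesis
      using 1 by (intro unit) auto
  next
    case 2
    have "map snd ss = []"
      by (rule sum_list_eq_length_less_1) (use less.prems 2 in auto)
    then show ?thesis
      using 2 by (intro unit) auto
  next
    case 3
    then obtain i p ss' j q ls' where eq: "ss = (i, p) # ss'" "ls = (j, q) # ls'"
      by (metis list.exhaust surj_pair)
    \<comment> \<open>What \<open>j\<close> keeps. From \<open>q \<ge> 1\<close> follows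
      \<open>r \<ge> p \<ge> 0\<close>, so \<open>(j, r)\<close> is admissible as a small item when
      \<open>r < 1\<close>.\<close>
    define r where "r = q - (1 - p)"
    have p: "0 \<le> p" "p < 1" and q: "1 \<le> q"
      using less.prems by (auto simp: eq)
    have "\<exists>cells. result A (if r < 1 then alias_cells 1 ((j, r) # ss') ls'
          else alias_cells 1 ss' ((j, r) # ls')) = return_pmf cells \<and>
        length cells = Suc (length ss' + length ls') \<and>
        (\<forall>(i, p, j) \<in> set cells. 0 \<le> p \<and> p \<le> 1) \<and>
        (\<forall>k. cell_mass cells k = of_bool (j = k) * r + item_mass ss' k + item_mass ls' k)"
    proof (cases "r < 1")
      case True
      show ?thesis
        using less.hyps[of "(j, r) # ss'" ls'] less.prems True p q
        by (auto simp: eq item_mass_def r_def)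
    next
      case False
      show ?thesis
        using less.hyps[of ss' "(j, r) # ls'"] less.prems False
        by (auto simp: eq item_mass_def r_def algebra_simps)
    qed
    then obtain cells where cells: "result A (if r < 1 then alias_cells 1 ((j, r) # ss') ls'
          else alias_cells 1 ss' ((j, r) # ls')) = return_pmf cells"
        "length cells = Suc (length ss' + length ls')"
        "\<forall>(i, p, j) \<in> set cells. 0 \<le> p \<and> p \<le> 1"
        "\<And>k. cell_mass cells k = of_bool (j = k) * r + item_mass ss' k + item_mass ls' k"
      by blast
    have "result A (alias_cells 1 ss ls) = return_pmf ((i, p, j) # cells)"
      using cells(1) by (simp add: eq bind_return_pmf r_def cong: if_cong split del: if_split)
    moreover have "cell_mass ((i, p, j) # cells) k = item_mass ss k + item_mass ls k" for k
      using cells(4)[of k] by (simp add: cell_mass_def item_mass_def eq r_def algebra_simps)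
    ultimately show ?thesis
      using cells(2,3) p by (intro exI[of _ "(i, p, j) # cells"]) (simp add: eq)
  qed
qed

lemma result_alias_table:
  assumes nonneg: "\<forall>w \<in> set ws. 0 \<le> w" and tot: "sum_list ws = tot" "tot > 0"
  shows "\<exists>cells. result A (alias_table ws tot) = return_pmf cells \<and>
    length cells = length ws \<and> (\<forall>(i, p, j) \<in> set cells. 0 \<le> p \<and> p \<le> 1) \<and>
    (\<forall>k. cell_mass cells k = (if k < length ws then real (length ws) * (ws ! k / tot) else 0))"
proof -
  define g where "g i = real (length ws) * (ws ! i / tot)" for i
  let ?items = "map (\<lambda>i. (g i < 1, i, g i)) [0..<length ws]"
  let ?ss = "map snd (filter fst ?items)" and ?ls = "map snd (filter (\<lambda>it. \<not> fst it) ?items)"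
  \<comment> \<open>Used twice: with \<open>h = snd\<close> for the total mass, and with the summand
    of \<open>item_mass\<close> for the mass of one point.\<close>
  have split: "sum_list (map h ?ss) + sum_list (map h ?ls) = (\<Sum>i<length ws. h (i, g i))"
    for h :: "nat \<times> real \<Rightarrow> real"
    using sum_list_filter_partition[of "h \<circ> snd" fst ?items]
    by (simp add: o_def interv_sum_list_conv_sum_set_nat atLeast0LessThan)
  have g_nonneg: "0 \<le> g i" if "i < length ws" for i
    using nonneg tot(2) that by (simp add: g_def)
  have "(\<Sum>i<length ws. ws ! i) = tot"
    using tot(1) by (simp add: sum_list_sum_nth atLeast0LessThan)
  then have "(\<Sum>i<length ws. g i) = real (length ws)"
    using tot(2) by (simp add: g_def sum_distrib_left[symmetric] sum_divide_distrib[symmetric])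
  moreover have len: "length ?ss + length ?ls = length ws"
    using sum_length_filter_compl[of fst ?items] by simp
  ultimately have sum: "sum_list (map snd ?ss) + sum_list (map snd ?ls) = real (length ?ss + length ?ls)"
    unfolding split len by simp
  have "\<exists>cells. result A (alias_cells 1 ?ss ?ls) = return_pmf cells \<and>
    length cells = length ?ss + length ?ls \<and> (\<forall>(i, p, j) \<in> set cells. 0 \<le> p \<and> p \<le> 1) \<and>
    (\<forall>k. cell_mass cells k = item_mass ?ss k + item_mass ?ls k)"
    by (rule result_alias_cells[OF _ _ sum]) (auto simp: g_nonneg)
  moreover have "item_mass ?ss k + item_mass ?ls k = (if k < length ws then g k else 0)" for k
  proof -
    have "item_mass ?ss k + item_mass ?ls k = (\<Sum>i<length ws. of_bool (i = k) * g i)"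
      unfolding item_mass_def split by simp
    also have "\<dots> = (\<Sum>i<length ws. if i = k then g i else 0)"
      by (intro sum.cong) auto
    finally show ?thesis
      by simp
  qed
  moreover have "result A (alias_table ws tot) = result A (alias_cells 1 ?ss ?ls)"
    unfolding alias_table_def
    by (simp add: result_map_prog_return[where g = "\<lambda>i. (g i < 1, i, g i)"] g_def bind_return_pmf)
  ultimately show ?thesis
    unfolding len g_def[symmetric] by simp
qed

text \<open>A uniform cell followed by a coin averages the cell masses. The bounds on
  \<open>p\<close> ensure that \<open>bernoulli_pmf p\<close> has exactly the weights
  \<open>p\<close> and \<open>1 - p\<close>.\<close>

lemma pmf_result_draw:
  assumes "cells \<noteq> []" "\<forall>(i, p, j) \<in> set cells. 0 \<le> p \<and> p \<le> 1"
  shows "pmf (result A (draw cells)) k = cell_mass cells k / length cells"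
proof -
  let ?pick = "\<lambda>(i, p, j). bind_pmf (bernoulli_pmf p) (\<lambda>b. return_pmf (if b then i else j))"
  have "pmf (?pick c) k = (case c of (i, p, j) \<Rightarrow> of_bool (i = k) * p + of_bool (j = k) * (1 - p))"
    if "c \<in> set cells" for c
    using assms(2) that by (auto simp: pmf_bind)
  then have "(\<Sum>m<length cells. pmf (?pick (cells ! m)) k) = cell_mass cells k"
    unfolding cell_mass_def
    by (simp add: sum_list_sum_nth atLeast0LessThan)
  moreover have "result A (draw cells) = bind_pmf (pmf_of_set {..<length cells}) (\<lambda>m. ?pick (cells ! m))"
    by (simp add: draw_def Let_def case_prod_unfold)
  ultimately show ?thesis
    using assms(1) by (simp add: pmf_bind_pmf_of_set lessThan_empty_iff)
qed

lemma result_trial: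
  assumes "psd_mat n A" "A \<noteq> 0\<^sub>m n n" "result A (draw cells) = diag_pmf A"
  shows "result A (trial (map (\<lambda>i. A $$ (i, i)) [0..<n]) cells) = trial_pmf A"
proof -
  \<comment> \<open>Looking up \<open>diag ! I\<close> gives the diagonal entry only for indices
    below \<open>n\<close>.\<close>
  have "i < n" if "i \<in> set_pmf (diag_pmf A)" for i
    using set_pmf_diag_pmf[OF assms(1,2)] that by auto
  then show ?thesis
    by (auto simp: trial_def trial_pmf_def assms(3) power2_eq_square intro!: bind_pmf_cong)
qed

lemma result_estimate_frobenius:
  assumes "n > 0" "psd_mat n A" "A \<noteq> 0\<^sub>m n n"
  shows "result A (estimate_frobenius n s) = estimate_pmf s A"
proof -
  let ?ws = "map (\<lambda>i. A $$ (i, i)) [0..<n]"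
  have A: "A \<in> carrier_mat n n"
    using assms by (simp add: psd_mat_def)
  have tr: "sum_list ?ws = mat_trace A"
    by (simp add: mat_trace_carrier[OF A] interv_sum_list_conv_sum_set_nat atLeast0LessThan)
  have pos: "mat_trace A > 0"
    by (rule psd_mat_trace_pos[OF assms(2,3)])
  obtain cells where cells: "result A (alias_table ?ws (mat_trace A)) = return_pmf cells"
      "length cells = n" "\<forall>(i, p, j) \<in> set cells. 0 \<le> p \<and> p \<le> 1"
      "\<And>k. cell_mass cells k = (if k < n then real n * (?ws ! k / mat_trace A) else 0)"
    using result_alias_table[OF _ tr pos, of A] psd_mat_diag_nonneg[OF assms(2)] by auto
  \<comment> \<open>The scaling factor \<open>n\<close> in the cell masses cancels the uniform
    probability 1/n of a cell.\<close>
  have "result A (draw cells) = diag_pmf A"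
    by (rule pmf_eqI, subst pmf_result_draw)
      (use cells assms(1) in \<open>auto simp: pmf_diag_pmf[OF assms(2,3)]\<close>)
  then have trial: "result A (trial ?ws cells) = trial_pmf A"
    by (rule result_trial[OF assms(2,3)])
  have read: "result A (map_prog (\<lambda>i. Query i i Return) [0..<n]) = return_pmf ?ws"
    by (rule result_map_prog_return) simp
  show ?thesis
    unfolding estimate_frobenius_def estimate_pmf_def
    by (simp add: read tr pos cells(1) bind_return_pmf result_map_prog_const trial
        map_pmf_def power2_eq_square)
qed

lemma result_estimate_frobenius_zero:
  "result (0\<^sub>m n n) (estimate_frobenius n s) = return_pmf 0"
proof -
  have "result (0\<^sub>m n n) (map_prog (\<lambda>i. Query i i Return) [0..<n]) =
      return_pmf (map (\<lambda>i. 0\<^sub>m n n $$ (i, i)) [0..<n])"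
    by (rule result_map_prog_return) simp
  moreover have "sum_list (map (\<lambda>i. 0\<^sub>m n n $$ (i, i)) [0..<n]) = (0 :: real)"
    by (simp add: interv_sum_list_conv_sum_set_nat)
  ultimately show ?thesis
    by (simp add: estimate_frobenius_def bind_return_pmf)
qed

section \<open>Accuracy and cost\<close>

lemma estimate_pmf_accuracy:
  assumes n: "n > 0" and A: "psd_mat n A" "A \<noteq> 0\<^sub>m n n"
    and \<epsilon>: "\<epsilon> \<in> {0<..<1}" and \<delta>: "\<delta> \<in> {0<..<1}"
  shows "measure_pmf.prob (estimate_pmf (num_trials n \<epsilon> \<delta>) A)
    {x. (1 - \<epsilon>) * (frobenius_norm A)\<^sup>2 \<le> x \<and> x \<le> (1 + \<epsilon>) * (frobenius_norm A)\<^sup>2} \<ge> 1 - \<delta>"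
    (is "measure_pmf.prob _ ?S \<ge> _")
proof -
  define s where "s = num_trials n \<epsilon> \<delta>"
  define T where "T = (mat_trace A)\<^sup>2"
  define F where "F = (frobenius_norm A)\<^sup>2"
  have T: "T > 0"
    using psd_mat_trace_pos[OF A] by (simp add: T_def)
  have TF: "T \<le> real n * F"
    using psd_mat_trace_square_le[OF A(1)] by (simp add: T_def F_def)
  have ln: "ln (2 / \<delta>) > 0"
    using \<delta> by simp
  have s_ge: "3 * real n * ln (2 / \<delta>) / \<epsilon>\<^sup>2 \<le> real s"
    unfolding s_def num_trials_def by (rule real_nat_ceiling_ge)
  moreover have "3 * real n * ln (2 / \<delta>) / \<epsilon>\<^sup>2 > 0"
    using n ln \<epsilon> by simp
  ultimately have s: "real s > 0"
    by linarith
  \<comment> \<open>Dividing by \<open>T\<close> and multiplying by \<open>s\<close>, both positive,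
    turns the event into one about the plain sum, with mean \<open>F / T\<close> per trial.\<close>
  have "measure_pmf.prob (estimate_pmf s A) ?S =
      measure_pmf.prob (replicate_pmf s (trial_pmf A))
        {xs. (1 - \<epsilon>) * (real s * (F / T)) \<le> sum_list xs \<and> sum_list xs \<le> (1 + \<epsilon>) * (real s * (F / T))}"
    unfolding estimate_pmf_def measure_map_pmf vimage_def T_def[symmetric] F_def[symmetric]
    using s T by (simp add: field_simps)
  moreover have "\<dots> \<ge> 1 - 2 * exp (- (real s * (F / T) * \<epsilon>\<^sup>2 / 3))"
    using chernoff_two_sided[OF set_pmf_trial_pmf[OF A] \<epsilon>, of s]
    by (simp add: expectation_trial_pmf[OF A] T_def F_def)
  moreover have "2 * exp (- (real s * (F / T) * \<epsilon>\<^sup>2 / 3)) \<le> \<delta>"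
  proof -
    have "1 / real n \<le> F / T"
      using TF T n by (simp add: field_simps)
    \<comment> \<open>The number of trials is chosen so that the exponent equals
      \<open>ln (2 / \<delta>)\<close> when the mean has its least value 1/n.\<close>
    have "ln (2 / \<delta>) = (3 * real n * ln (2 / \<delta>) / \<epsilon>\<^sup>2) * (1 / real n) * \<epsilon>\<^sup>2 / 3"
      using n \<epsilon> by simp
    also have "\<dots> \<le> real s * (F / T) * \<epsilon>\<^sup>2 / 3"
      using s_ge s \<open>1 / real n \<le> F / T\<close>
      by (intro divide_right_mono mult_right_mono mult_mono) auto
    finally have "exp (- (real s * (F / T) * \<epsilon>\<^sup>2 / 3)) \<le> exp (- ln (2 / \<delta>))"
      by simp
    also have "\<dots> = \<delta> / 2"
      using \<delta> by (simp add: exp_minus)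
    finally show ?thesis
      by simp
  qed
  ultimately show ?thesis
    by (simp add: s_def)
qed

text \<open>Here 24 is 8 times the 3 in the number of trials, and 25 is 7 + 8 + 10: rounding up adds
  at most one trial, and both 1 and \<open>n\<close> are at most \<open>N\<close>.\<close>

lemma num_trials_cost:
  assumes n: "n > 0" and \<epsilon>: "\<epsilon> \<in> {0<..<1}" and \<delta>\<^sub>0: "\<delta>\<^sub>0 \<in> {0<..<1}" and \<delta>: "\<delta> \<in> {0<..\<delta>\<^sub>0}"
  shows "7 * real n + 8 * real (num_trials n \<epsilon> \<delta>) + 10 \<le>
    (24 + (24 * ln 2 + 25) / ln (1 / \<delta>\<^sub>0)) * (real n * ln (1 / \<delta>) / \<epsilon>\<^sup>2)"
proof -
  define L\<^sub>0 where "L\<^sub>0 = ln (1 / \<delta>\<^sub>0)"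
  define N where "N = real n / \<epsilon>\<^sup>2"
  have L\<^sub>0: "L\<^sub>0 > 0"
    using \<delta>\<^sub>0 by (simp add: L\<^sub>0_def)
  have L: "L\<^sub>0 \<le> ln (1 / \<delta>)"
    using \<delta> \<delta>\<^sub>0 by (auto simp: L\<^sub>0_def frac_le)
  have ln2: "ln (2 / \<delta>) = ln 2 + ln (1 / \<delta>)"
    using \<delta> by (simp add: ln_div)
  have "\<epsilon>\<^sup>2 \<le> 1"
    using \<epsilon> by (simp add: power_le_one)
  then have "real n * \<epsilon>\<^sup>2 \<le> real n"
    by (simp add: mult_left_le)
  then have nN: "real n \<le> N"
    using \<epsilon> by (simp add: N_def pos_le_divide_eq)
  have "3 * real n * ln (2 / \<delta>) / \<epsilon>\<^sup>2 \<ge> 0"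
    using \<delta> \<delta>\<^sub>0 by simp
  then have "real (num_trials n \<epsilon> \<delta>) \<le> 3 * real n * ln (2 / \<delta>) / \<epsilon>\<^sup>2 + 1"
    unfolding num_trials_def by linarith
  also have "3 * real n * ln (2 / \<delta>) / \<epsilon>\<^sup>2 = 3 * (ln 2 + ln (1 / \<delta>)) * N"
    by (simp add: N_def ln2)
  finally have cost: "7 * real n + 8 * real (num_trials n \<epsilon> \<delta>) + 10 \<le>
      24 * ln (1 / \<delta>) * N + (24 * ln 2 + 25) * N"
    using nN n by (simp add: algebra_simps)
  \<comment> \<open>The part without \<open>ln (1 / \<delta>)\<close> is absorbed because
    \<open>ln (1 / \<delta>) / L\<^sub>0\<close> is at least 1.\<close>
  have "(24 * ln 2 + 25) * N * 1 \<le> (24 * ln 2 + 25) * N * (ln (1 / \<delta>) / L\<^sub>0)"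
    using L L\<^sub>0 nN by (intro mult_left_mono) auto
  then have "24 * ln (1 / \<delta>) * N + (24 * ln 2 + 25) * N \<le>
      (24 + (24 * ln 2 + 25) / L\<^sub>0) * (N * ln (1 / \<delta>))"
    by (simp add: algebra_simps add_divide_distrib)
  with cost show ?thesis
    by (simp add: N_def L\<^sub>0_def)
qed

theorem theorem2:
  shows
    "(\<forall>(n::nat) (A::real mat) (\<epsilon>::real) (\<delta>::real).
        n > 0 \<longrightarrow> psd_mat n A \<longrightarrow> \<epsilon> \<in> {0<..<1} \<longrightarrow> \<delta> \<in> {0<..<1} \<longrightarrow>
        (let s = num_trials n \<epsilon> \<delta>;
             F = map_pmf fst (run A (estimate_frobenius n s))
         in (A \<noteq> 0\<^sub>m n n \<longrightarrow> F = estimate_pmf s A) \<and>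
            measure_pmf.prob F
              {x. (1 - \<epsilon>) * (frobenius_norm A)\<^sup>2 \<le> x \<and> x \<le> (1 + \<epsilon>) * (frobenius_norm A)\<^sup>2}
              \<ge> 1 - \<delta>))
     \<and>
     (\<forall>\<delta>\<^sub>0 \<in> {0<..<1::real}. \<exists>C::real.
        \<forall>(n::nat) (A::real mat) (\<epsilon>::real) (\<delta>::real).
          n > 0 \<longrightarrow> psd_mat n A \<longrightarrow> \<epsilon> \<in> {0<..<1} \<longrightarrow> \<delta> \<in> {0<..\<delta>\<^sub>0} \<longrightarrow>
          (\<forall>(x, queries, ops) \<in> set_pmf (run A (estimate_frobenius n (num_trials n \<epsilon> \<delta>))).
             real queries \<le> C * (real n * ln (1 / \<delta>) / \<epsilon>\<^sup>2) \<and>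
             real ops \<le> C * (real n * ln (1 / \<delta>) / \<epsilon>\<^sup>2)))"
proof (intro conjI allI impI ballI, goal_cases)
  case (1 n A \<epsilon> \<delta>)
  show ?case
  proof (cases "A = 0\<^sub>m n n")
    case True
    have "frobenius_norm (0\<^sub>m n n) = 0"
      by (simp add: frobenius_norm_def)
    then show ?thesis
      unfolding Let_def result_def[symmetric] True result_estimate_frobenius_zero
      using 1 by simp
  next
    case False
    then show ?thesis
      unfolding Let_def result_def[symmetric] result_estimate_frobenius[OF 1(1,2) False]
      using 1 estimate_pmf_accuracy by blast
  qed
next
  case (2 \<delta>\<^sub>0)
  show ?case
  proof (intro exI[of _ "24 + (24 * ln 2 + 25) / ln (1 / \<delta>\<^sub>0)"] allI impI, goal_cases)
    case (1 n A \<epsilon> \<delta>)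
    show ?case
      \<comment> \<open>The bound on operations also dominates the query count \<open>n + s\<close>,
        so one constant serves both.\<close>
      using cost_le_estimate_frobenius[of A n "num_trials n \<epsilon> \<delta>"]
        num_trials_cost[OF 1(1) 1(3) 2 1(4)]
      unfolding cost_le_def by fastforce
  qed
qed

end
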